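(* Let $N$ be a 3-prime left near-ring with multiplicative center $Z$, and let $d : N \to N$ be a nonzero multiplicative derivation of $N$. If $[d(x),y] \in Z$ for all $x,y \in N$, then $N$ is a commutative ring.
   Context: A (left) near-ring is a set $N$ with two binary operations $+$ and $\cdot$ such that $(N,+)$ is a group (not assumed abelian, written additively with identity $0$), multiplication is associative, and $x(y+z) = xy + xz$ for all $x,y,z \in N$ (right distributivity and a multiplicative identity are not assumed). $N$ is 3-prime if, for $x,y \in N$, $xNy = \{0\}$ (i.e. $xny = 0$ for all $n \in N$) implies $x = 0$ or $y = 0$. The multiplicative center is $Z = \{x \in N : yx = xy \text{ for all } y \in N\}$. For $x,y \in N$, $[x,y] = xy - yx$. A multiplicative derivation of $N$ is a map $d : N \to N$, not assumed additive, with $d(xy) = x d(y) + d(x) y$ for all $x,y \in N$; it is nonzero if it is not identically $0$. That $N$ is a commutative ring means that $(N,+)$ is abelian, multiplication is commutative, and both distributive laws hold (no identity is required). *)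

theory Defs
  imports Main
begin

text \<open>
  Addition need not be commutative and there is no multiplicative identity. Only
  \<open>x * 0 = 0\<close> follows from the axioms; \<open>0 * x = 0\<close> is not assumed.
\<close>

class left_near_ring = group_add + semigroup_mult +
  assumes left_distrib: "x * (y + z) = x * y + x * z"

class three_prime_left_near_ring = left_near_ring +
  assumes three_prime: "(\<forall>n. x * n * y = 0) \<Longrightarrow> x = 0 \<or> y = 0"

definition mult_center :: "'a::times set" where
  "mult_center = {x. \<forall>y. y * x = x * y}"

definition mult_commutator :: "'a::left_near_ring \<Rightarrow> 'a \<Rightarrow> 'a" where
  "mult_commutator x y = x * y - y * x"

definition multiplicative_derivation :: "('a::left_near_ring \<Rightarrow> 'a) \<Rightarrow> bool" where
  "multiplicative_derivation d \<longleftrightarrow> (\<forall>x y. d (x * y) = x * d y + d x * y)"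

text \<open>
  The positional arguments of \<open>class.comm_ring\<close> are addition, zero, subtraction, negation and
  multiplication. It has no unit, and for the operations of a left near-ring it amounts to the
  following.
\<close>

lemma comm_ring_iff:
  "class.comm_ring ((+) :: 'a::left_near_ring \<Rightarrow> 'a \<Rightarrow> 'a) 0 (-) uminus (*) \<longleftrightarrow>
    (\<forall>x y :: 'a. x + y = y + x) \<and> (\<forall>x y :: 'a. x * y = y * x) \<and>
    (\<forall>x y z :: 'a. x * (y + z) = x * y + x * z) \<and>
    (\<forall>x y z :: 'a. (x + y) * z = x * z + y * z)"
  (is "?ring \<longleftrightarrow> ?laws")
proof
  assume ?ring
  then interpret R: comm_ring "(+) :: 'a \<Rightarrow> 'a \<Rightarrow> 'a" 0 "(-)" uminus "(*)" .
  show ?laws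
    using R.add.commute R.mult.commute R.distrib_left R.distrib_right by blast
next
  assume ?laws
  then show ?ring
    by unfold_locales (auto simp: mult.assoc add.assoc)
qed

end

theory Submission
  imports Defs
begin

text \<open>
  Since \<open>[d x, d x * y] = d x * [d x, y]\<close>, both \<open>[d x, y]\<close> and its product with \<open>d x\<close> are central.
  A nonzero central element of a 3-prime near-ring can be cancelled, so \<open>d x\<close> is central as soon as
  some \<open>[d x, y]\<close> is nonzero, while if all of them vanish \<open>d x\<close> is central anyway. Hence all
  values of \<open>d\<close> are central. Now let \<open>d (x * y)\<close> commute with \<open>z\<close>. Taking \<open>z = x\<close> gives
  \<open>d x * [x, y] = 0\<close>, so \<open>x\<close> is central if \<open>d x \<noteq> 0\<close>; and if \<open>d x = 0\<close>, then
  \<open>d y * [z, x] = 0\<close>, so \<open>x\<close> is central because some \<open>d y\<close> is nonzero. Thus multiplication is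
  commutative, and expanding \<open>(x + y) * (z + z)\<close> in two ways makes addition commutative.
\<close>

lemma left_near_ring_mult_zero_right [simp]: "x * 0 = (0 :: 'a::left_near_ring)"
  using left_distrib[of x 0 0] add_left_cancel[of "x * 0" 0 "x * 0"] by simp

lemma left_near_ring_right_diff_distrib:
  "x * (y - z) = x * y - x * (z :: 'a::left_near_ring)"
  by (simp add: eq_diff_eq flip: left_distrib)

lemma mem_mult_center_iff: "x \<in> mult_center \<longleftrightarrow> (\<forall>y. y * x = x * y)"
  by (simp add: mult_center_def)

text \<open>Centrality moves \<open>z\<close> past any \<open>n\<close>, so
  \<open>z * (a - b) = 0\<close> already gives \<open>z * n * (a - b) = 0\<close>, and 3-primeness
  applies.\<close>

lemma mult_center_mult_cancel_left:
  fixes z :: "'a::three_prime_left_near_ring"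
  assumes "z \<in> mult_center" "z \<noteq> 0" "z * a = z * b"
  shows "a = b"
proof -
  have "z * (a - b) = 0"
    using assms(3) by (simp add: left_near_ring_right_diff_distrib)
  have "z * n * (a - b) = 0" for n
  proof -
    have "z * n * (a - b) = n * z * (a - b)"
      using assms(1) by (simp add: mem_mult_center_iff)
    with \<open>z * (a - b) = 0\<close> show ?thesis
      by (simp add: mult.assoc)
  qed
  then show ?thesis
    using three_prime[of z "a - b"] assms(2) by simp
qed

lemma multiplicative_derivationD:
  "multiplicative_derivation d \<Longrightarrow> d (x * y) = x * d y + d x * y"
  by (simp add: multiplicative_derivation_def)

text \<open>
  Right distributivity is not available in general; here it comes from computing
  \<open>d (x * y * z)\<close> in two ways.
\<close>

lemma multiplicative_derivation_partial_distrib: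
  assumes "multiplicative_derivation d"
  shows "(x * d y + d x * y) * z = x * d y * z + d x * y * z"
proof -
  have "x * y * d z + (x * d y + d x * y) * z = d (x * y * z)"
    by (simp only: multiplicative_derivationD[OF assms])
  also have "\<dots> = d (x * (y * z))"
    by (simp only: mult.assoc)
  also have "\<dots> = x * y * d z + (x * d y * z + d x * y * z)"
    by (simp only: multiplicative_derivationD[OF assms] left_distrib mult.assoc add.assoc)
  finally show ?thesis
    by simp
qed

lemma derivation_range_central:
  fixes d :: "'a::three_prime_left_near_ring \<Rightarrow> 'a"
  assumes comm: "\<And>x y. mult_commutator (d x) y \<in> mult_center"
  shows "d x \<in> mult_center"
proof (rule ccontr)
  assume not_central: "d x \<notin> mult_center"
  then obtain t where t: "t * d x \<noteq> d x * t"
    by (auto simp: mem_mult_center_iff)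
  let ?c = "mult_commutator (d x) t"
  have c: "?c \<in> mult_center" "?c \<noteq> 0"
    using comm t by (auto simp: mult_commutator_def)
  have "mult_commutator (d x) (d x * t) = d x * ?c"
    by (simp add: mult_commutator_def left_near_ring_right_diff_distrib mult.assoc)
  with comm[of x "d x * t"] have dc: "d x * ?c \<in> mult_center"
    by simp
  \<comment> \<open>Centrality of \<open>d x * ?c\<close> lets \<open>t\<close> pass it as a block;
    pulling \<open>?c\<close> to the front then leaves a factor to cancel.\<close>
  have "?c * (t * d x) = t * d x * ?c"
    using c(1) unfolding mem_mult_center_iff by metis
  also have "\<dots> = t * (d x * ?c)"
    by (rule mult.assoc)
  also have "\<dots> = d x * ?c * t"
    using dc unfolding mem_mult_center_iff by blast
  also have "d x * ?c = ?c * d x"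
    using c(1) unfolding mem_mult_center_iff by blast
  also have "\<dots> * t = ?c * (d x * t)"
    by (rule mult.assoc)
  finally have "t * d x = d x * t"
    by (rule mult_center_mult_cancel_left[OF c])
  with t show False
    by contradiction
qed

text \<open>Centrality gives \<open>0 * d x = d x * 0 = 0\<close>. Hence \<open>d\<close> fixes
  \<open>0 * y\<close>, which is thus a value of \<open>d\<close> and is killed by \<open>0\<close>
  on the left; but \<open>0 * (0 * y) = 0 * y\<close>.\<close>

lemma central_derivation_mult_zero_left:
  fixes d :: "'a::left_near_ring \<Rightarrow> 'a"
  assumes "multiplicative_derivation d" and central: "\<And>x. d x \<in> mult_center"
  shows "0 * y = (0 :: 'a)"
proof -
  note der = multiplicative_derivationD[OF assms(1)]
  have zero_d: "0 * d x = 0" for x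
    using central[of x] by (simp add: mem_mult_center_iff)
  have "d 0 = 0"
    using der[of 0 0] by (simp add: zero_d)
  then have "d (0 * y) = 0 * y"
    by (simp add: der zero_d)
  then have "0 * (0 * y) = 0"
    using zero_d[of "0 * y"] by simp
  then show ?thesis
    by (simp flip: mult.assoc)
qed

lemma central_derivation_mult_commute:
  fixes d :: "'a::three_prime_left_near_ring \<Rightarrow> 'a"
  assumes der: "multiplicative_derivation d" and nonzero: "\<exists>x. d x \<noteq> 0"
    and central: "\<And>x. d x \<in> mult_center"
  shows "x * z = z * (x :: 'a)"
proof -
  have d_commute: "z * d x = d x * z" for x z
    using central[of x] unfolding mem_mult_center_iff by blast
  have key: "z * x * d y + z * d x * y = x * d y * z + d x * y * z" for x y z
    using d_commute[of z "x * y"]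
    by (simp only: multiplicative_derivationD[OF der] left_distrib
        multiplicative_derivation_partial_distrib[OF der] mult.assoc)
  show ?thesis
  proof (cases "d x = 0")
    case True
    obtain y where y: "d y \<noteq> 0"
      using nonzero by blast
    \<comment> \<open>With \<open>d x = 0\<close>, the second summands on both sides of
      \<open>key\<close> start from a zero factor and vanish.\<close>
    have "z * x * d y = x * d y * z"
      using key[of z x y] True
      by (simp add: mult.assoc central_derivation_mult_zero_left[OF der central])
    then have "d y * (x * z) = d y * (z * x)"
      by (simp only: d_commute mult.assoc)
    then show ?thesis
      by (rule mult_center_mult_cancel_left[OF central y])
  next
    case False
    have "x * x * d z = x * d z * x"
      by (simp only: d_commute mult.assoc)
    \<comment> \<open>The first summands of this instance of \<open>key\<close> agree and
      cancel.\<close>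
    then have "x * d x * z = d x * z * x"
      using key[of x x z] by simp
    then have "d x * (x * z) = d x * (z * x)"
      by (simp only: d_commute mult.assoc)
    then show ?thesis
      by (rule mult_center_mult_cancel_left[OF central False])
  qed
qed

lemma add_commute_if_mult_commute:
  fixes x y z :: "'a::three_prime_left_near_ring"
  assumes commute: "\<And>x y :: 'a. x * y = y * x" and "z \<noteq> 0"
  shows "x + y = y + x"
proof -
  have right: "(a + b) * c = a * c + b * c" for a b c :: 'a
    by (simp only: commute[of _ c] left_distrib)
  have "x * z + (x * z + (y * z + y * z)) = x * (z + z) + y * (z + z)"
    by (simp only: left_distrib add.assoc)
  also have "\<dots> = (x + y) * (z + z)"
    by (rule right[symmetric])
  also have "\<dots> = (x + y) * z + (x + y) * z"
    by (rule left_distrib)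
  also have "\<dots> = x * z + (y * z + (x * z + y * z))"
    by (simp only: right add.assoc)
  finally have "(x * z + y * z) + y * z = (y * z + x * z) + y * z"
    by (simp add: add.assoc)
  then have "x * z + y * z = y * z + x * z"
    by (rule add_right_imp_eq)
  then have "z * (x + y) = z * (y + x)"
    by (simp only: left_distrib commute[of z])
  moreover have "z \<in> mult_center"
    unfolding mem_mult_center_iff using commute by blast
  ultimately show ?thesis
    by (rule mult_center_mult_cancel_left[OF _ assms(2), rotated])
qed

theorem theorem6:
  fixes d :: "'a::three_prime_left_near_ring \<Rightarrow> 'a"
  assumes "multiplicative_derivation d"
    and "\<exists>x. d x \<noteq> 0"
    and "\<forall>x y. mult_commutator (d x) y \<in> mult_center"
  shows "class.comm_ring ((+) :: 'a \<Rightarrow> 'a \<Rightarrow> 'a) 0 (-) uminus (*)"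
proof -
  have "d x \<in> mult_center" for x
    using assms(3) derivation_range_central[of d] by blast
  then have commute: "x * y = y * x" for x y :: 'a
    by (rule central_derivation_mult_commute[OF assms(1,2)])
  \<comment> \<open>A nonzero value of \<open>d\<close> serves as the element \<open>z\<close> to
    cancel.\<close>
  moreover have "x + y = y + x" for x y :: 'a
    using add_commute_if_mult_commute[OF commute] assms(2) by blast
  moreover have "(x + y) * z = x * z + y * z" for x y z :: 'a
    by (simp only: commute[of _ z] left_distrib)
  ultimately show ?thesis
    unfolding comm_ring_iff using left_distrib by blast
qed

end
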